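(* Let $D$ be a super edge-magic labeled digraph of order and size equal to $p$, whose vertices are named by their labels. Let $\mathcal{S}_n^k$ be the set of all super edge-magic labeled (simple) digraphs with order and size equal to $n$ and magic sum $k$, each vertex named by its label. Define $D_1=D$ and, for each $i\ge1$, $D_{i+1}=D_i\otimes_{h_i}\mathcal{S}_n^k$, where $h_i:E(D_i)\to\mathcal{S}_n^k$ are arbitrary functions. Then, for every $i\ge1$, $D_i$ admits at least $i+1$ edge-magic labelings with $i+1$ distinct magic sums.
   Context: All graphs are simple; labelings of digraphs are labelings of their underlying graphs. For a graph with $p$ vertices and $q$ edges, an edge-magic labeling is a bijection $f:V\cup E\to\{1,\dots,p+q\}$ such that $f(x)+f(xy)+f(y)$ is constant (the magic sum) over all edges $xy$; it is super edge-magic if also $f(V)=\{1,\dots,p\}$. Product: for a digraph $D$, a family $\Gamma$ of digraphs with common vertex set $V$ (here $\{1,\dots,n\}$) and $h:E(D)\to\Gamma$, $D\otimes_h\Gamma$ has vertex set $V(D)\times V$ and $((a,x),(b,y))$ is an arc iff $(a,b)\in E(D)$ and $(x,y)\in E(h(a,b))$. *)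

theory Defs
  imports "HOL-Library.FuncSet" "Graph_Theory.Pair_Digraph"
begin

text \<open>
  A digraph is simple when its underlying graph, with one edge per arc, is a simple graph:
  there are no loops and no pairs of opposite arcs. Hence the number of arcs of a simple digraph
  (its size) is also the number of edges of the underlying graph. Graphs have at least one vertex.
\<close>

definition simple_digraph :: "'a pair_pre_digraph \<Rightarrow> bool" where
  "simple_digraph D \<longleftrightarrow> pair_digraph D \<and> asym (parcs D) \<and> pverts D \<noteq> {}"

definition und_edges :: "'a pair_pre_digraph \<Rightarrow> 'a set set" where
  "und_edges D = {{x, y} | x y. (x, y) \<in> parcs D}"

text \<open>
  The set of labelled elements is the disjoint union of the vertices (tagged \<open>Inl\<close>) and the
  edges of the underlying graph (tagged \<open>Inr\<close>); \<open>k\<close> is the magic sum.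
\<close>

definition edge_magic_labeling :: "'a pair_pre_digraph \<Rightarrow> ('a + 'a set \<Rightarrow> nat) \<Rightarrow> nat \<Rightarrow> bool" where
  "edge_magic_labeling D f k \<longleftrightarrow>
     bij_betw f (pverts D <+> und_edges D) {1..card (pverts D) + card (und_edges D)} \<and>
     (\<forall>x y. {x, y} \<in> und_edges D \<longrightarrow> f (Inl x) + f (Inr {x, y}) + f (Inl y) = k)"

definition super_edge_magic_labeling ::
    "'a pair_pre_digraph \<Rightarrow> ('a + 'a set \<Rightarrow> nat) \<Rightarrow> nat \<Rightarrow> bool" where
  "super_edge_magic_labeling D f k \<longleftrightarrow>
     edge_magic_labeling D f k \<and> f ` Inl ` pverts D = {1..card (pverts D)}"

text \<open>
  The set \<open>\<S>\<^sub>n\<^sup>k\<close>. Naming each vertex by its label means that the vertices are numbers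
  and that the labeling fixes them; the vertex set is then \<open>{1..n}\<close>.
\<close>

definition sem_digraphs :: "nat \<Rightarrow> nat \<Rightarrow> nat pair_pre_digraph set" where
  "sem_digraphs n k =
     {D. simple_digraph D \<and> card (pverts D) = n \<and> card (parcs D) = n \<and>
         (\<exists>f. super_edge_magic_labeling D f k \<and> (\<forall>v\<in>pverts D. f (Inl v) = v))}"

text \<open>\<open>V\<close> is the common vertex set of the family in which \<open>h\<close> takes its values.\<close>

definition otimes_digraph ::
    "'a pair_pre_digraph \<Rightarrow> ('a \<times> 'a \<Rightarrow> 'b pair_pre_digraph) \<Rightarrow> 'b set \<Rightarrow> ('a \<times> 'b) pair_pre_digraph"
  where
  "otimes_digraph D h V =
     \<lparr> pverts = pverts D \<times> V,
       parcs = {((a, x), (b, y)) | a x b y. (a, b) \<in> parcs D \<and> (x, y) \<in> parcs (h (a, b))} \<rparr>"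

text \<open>
  The vertices of an iterated product are nested pairs \<open>((\<dots>(a, x\<^sub>1), \<dots>), x\<^sub>m)\<close> whose
  depth depends on the number of factors. The following datatype holds such pairs of all depths;
  as its constructors are free, renaming by \<open>Vert\<close> or by \<open>\<lambda>(a, x). VPair a x\<close>
  yields an isomorphic copy.
\<close>

datatype vertex = Vert nat | VPair vertex nat

definition rename_digraph :: "('a \<Rightarrow> 'b) \<Rightarrow> 'a pair_pre_digraph \<Rightarrow> 'b pair_pre_digraph" where
  "rename_digraph g D =
     \<lparr> pverts = g ` pverts D, parcs = map_prod g g ` parcs D \<rparr>"

end

theory Submission
  imports Defs
begin

text \<open>
  Let the labels start at 0. A super edge-magic labeling of a digraph of order and size \<open>M\<close>
  labels vertices and arcs separately by \<open>0, \<dots>, M - 1\<close>, with a constant \<open>W\<close> as magic sum, and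
  an edge-magic labeling arises by inserting a bit into the label that tells arcs from vertices.
  A product with \<open>\<S>\<^sub>n\<^sup>k\<close> appends a base-\<open>n\<close> digit, so the labels of \<open>D\<^sub>i\<close> have \<open>i\<close> digits and
  the bit can be put in \<open>i + 1\<close> positions. Each product keeps the magic sums obtained so far
  distinct, and putting the bit in the new lowest position gives a larger sum than all the others.
\<close>

section \<open>Labels counted from 0 and determined by the vertices\<close>

text \<open>
  An arc is labelled by whatever its ends leave to the magic sum. Only surjectivity is required;
  by counting it implies bijectivity.
\<close>

definition arc_magic :: "'a pair_pre_digraph \<Rightarrow> ('a \<Rightarrow> nat) \<Rightarrow> nat \<Rightarrow> bool" where
  "arc_magic D l w \<longleftrightarrow>
     (\<forall>t < card (pverts D) + card (parcs D).
        (\<exists>v\<in>pverts D. l v = t) \<or> (\<exists>(x, y)\<in>parcs D. l x + l y + t = w))"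

definition super_arc_magic :: "'a pair_pre_digraph \<Rightarrow> ('a \<Rightarrow> nat) \<Rightarrow> nat \<Rightarrow> bool" where
  "super_arc_magic D l w \<longleftrightarrow>
     card (parcs D) = card (pverts D) \<and>
     (\<forall>t < card (pverts D). (\<exists>v\<in>pverts D. l v = t) \<and> (\<exists>(x, y)\<in>parcs D. l x + l y + t = w))"

section \<open>Counting, and simple digraphs\<close>

text \<open>The image of \<open>A\<close> has at most \<open>card B\<close> elements, which leaves
  no room for values outside \<open>B\<close> or for repeated values.\<close>

lemma bij_betw_if_onto_card:
  assumes "finite A" and "B \<subseteq> f ` A" and "card A = card B"
  shows "bij_betw f A B"
proof -
  have "card (f ` A) \<le> card B"
    using card_image_le[OF assms(1), of f] assms(3) by simp
  then have im: "f ` A = B"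
    using assms(1,2) by (metis card_seteq finite_imageI)
  then have "inj_on f A"
    using assms(1,3) by (simp add: eq_card_imp_inj_on)
  with im show ?thesis
    by (simp add: bij_betw_def)
qed

lemma simple_digraphD:
  assumes "simple_digraph D"
  shows "finite (pverts D)" "finite (parcs D)" "pverts D \<noteq> {}"
    and "(x, y) \<in> parcs D \<Longrightarrow> x \<in> pverts D" "(x, y) \<in> parcs D \<Longrightarrow> y \<in> pverts D"
    and "(x, y) \<in> parcs D \<Longrightarrow> x \<noteq> y" "(x, y) \<in> parcs D \<Longrightarrow> (y, x) \<notin> parcs D"
proof -
  interpret pair_digraph D
    using assms by (simp add: simple_digraph_def)
  show "finite (pverts D)" "finite (parcs D)" "pverts D \<noteq> {}"
    using assms by (auto simp: simple_digraph_def)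
  show "(x, y) \<in> parcs D \<Longrightarrow> x \<in> pverts D" "(x, y) \<in> parcs D \<Longrightarrow> y \<in> pverts D"
    using in_arcsD1 in_arcsD2 by auto
  show "(x, y) \<in> parcs D \<Longrightarrow> x \<noteq> y" "(x, y) \<in> parcs D \<Longrightarrow> (y, x) \<notin> parcs D"
    using assms by (auto simp: simple_digraph_def asym_iff)
qed

lemma simple_digraphI:
  assumes "finite (pverts D)" "finite (parcs D)" "pverts D \<noteq> {}"
    and "parcs D \<subseteq> pverts D \<times> pverts D"
    and asym: "\<And>x y. (x, y) \<in> parcs D \<Longrightarrow> (y, x) \<notin> parcs D"
  shows "simple_digraph D"
  unfolding simple_digraph_def
proof (intro conjI)
  have "x \<noteq> y" if "(x, y) \<in> parcs D" for x y
    using asym[OF that] that by blast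
  then show "pair_digraph D"
    using assms(1-4) by unfold_locales auto
qed (use assms in \<open>auto intro: asymI\<close>)

lemma und_edges_eq: "und_edges D = (\<lambda>(x, y). {x, y}) ` parcs D"
  by (auto simp: und_edges_def)

text \<open>Without opposite arcs, distinct arcs have distinct underlying edges. Hence arcs can be
  counted in place of edges.\<close>

lemma card_und_edges:
  assumes "simple_digraph D"
  shows "card (und_edges D) = card (parcs D)"
proof -
  have "inj_on (\<lambda>(x, y). {x, y}) (parcs D)"
    using simple_digraphD(7)[OF assms] by (auto simp: inj_on_def doubleton_eq_iff)
  then show ?thesis
    unfolding und_edges_eq by (rule card_image)
qed

section \<open>Injective renaming of vertices\<close>

lemma simple_rename_digraph:
  assumes "simple_digraph D" and "inj g"
  shows "simple_digraph (rename_digraph g D)"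
proof (rule simple_digraphI)
  fix x y
  assume "(x, y) \<in> parcs (rename_digraph g D)"
  then obtain a b where ab: "(a, b) \<in> parcs D" "x = g a" "y = g b"
    by (auto simp: rename_digraph_def)
  have "a = d \<and> b = c" if "(y, x) = map_prod g g (c, d)" for c d
    using that ab(2,3) assms(2) by (simp add: inj_eq)
  then show "(y, x) \<notin> parcs (rename_digraph g D)"
    using simple_digraphD(7)[OF assms(1) ab(1)] by (auto simp: rename_digraph_def)
qed (use simple_digraphD[OF assms(1)] in \<open>auto simp: rename_digraph_def\<close>)

lemma card_rename_digraph:
  assumes "inj g"
  shows "card (pverts (rename_digraph g D)) = card (pverts D)"
    and "card (parcs (rename_digraph g D)) = card (parcs D)"
  using card_image[OF inj_on_subset[OF assms subset_UNIV], of "pverts D"]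
    card_image[OF inj_on_subset[OF prod.inj_map[OF assms assms] subset_UNIV], of "parcs D"]
  by (simp_all add: rename_digraph_def)

lemma arc_magic_rename:
  assumes "inj g"
  shows "arc_magic (rename_digraph g D) l w \<longleftrightarrow> arc_magic D (l \<circ> g) w"
  unfolding arc_magic_def card_rename_digraph[OF assms]
  by (simp add: rename_digraph_def split_def)

lemma super_arc_magic_rename:
  assumes "inj g"
  shows "super_arc_magic (rename_digraph g D) l w \<longleftrightarrow> super_arc_magic D (l \<circ> g) w"
  unfolding super_arc_magic_def card_rename_digraph[OF assms]
  by (simp add: rename_digraph_def split_def)

section \<open>Passage to edge-magic labelings\<close>

text \<open>The missing label is taken in the integers, so that surjectivity also shows that it is nonnegative.\<close>

lemma arc_magic_le:
  assumes "simple_digraph D" and "arc_magic D l w" and "(x, y) \<in> parcs D"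
  shows "l x + l y \<le> w"
proof -
  define g where "g = case_sum (int \<circ> l) (\<lambda>(x, y). int w - int (l x + l y))"
  let ?N = "card (pverts D) + card (parcs D)"
  have "bij_betw g (pverts D <+> parcs D) (int ` {..<?N})"
  proof (rule bij_betw_if_onto_card)
    show "int ` {..<?N} \<subseteq> g ` (pverts D <+> parcs D)"
    proof (rule image_subsetI)
      fix t assume "t \<in> {..<?N}"
      then consider v where "v \<in> pverts D" "l v = t"
        | x y where "(x, y) \<in> parcs D" "l x + l y + t = w"
        using assms(2) unfolding arc_magic_def by blast
      then show "int t \<in> g ` (pverts D <+> parcs D)"
      proof cases
        case 1
        then show ?thesis
          by (intro image_eqI[of _ _ "Inl v"]) (auto simp: g_def)
      next
        case 2
        then show ?thesis
          by (intro image_eqI[of _ _ "Inr (x, y)"]) (auto simp: g_def)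
      qed
    qed
  qed (use simple_digraphD[OF assms(1)] in \<open>auto simp: card_Plus card_image\<close>)
  then have "g (Inr (x, y)) \<in> int ` {..<?N}"
    using assms(3) by (auto dest!: bij_betw_imp_surj_on)
  then show ?thesis
    by (auto simp: g_def)
qed

text \<open>Moving the least label from 0 to 1 adds 1 to each of the three labels on an edge, whence
  the 3.\<close>

lemma arc_magic_imp_edge_magic_labeling:
  assumes "simple_digraph D" and "arc_magic D l w"
  shows "\<exists>f. edge_magic_labeling D f (w + 3)"
proof -
  define f where "f = case_sum (Suc \<circ> l) (\<lambda>E. Suc w - sum l E)"
  let ?N = "card (pverts D) + card (parcs D)"
  \<comment> \<open>The bound \<open>arc_magic_le\<close> keeps the subtraction in \<open>f\<close>
    from truncating, and the absence of loops makes \<open>sum l {x, y}\<close> equal to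
    \<open>l x + l y\<close>.\<close>
  have edge: "f (Inr {x, y}) + l x + l y = Suc w" if "(x, y) \<in> parcs D" for x y
    using that arc_magic_le[OF assms that] simple_digraphD(6)[OF assms(1) that]
    by (simp add: f_def)
  have "bij_betw f (pverts D <+> und_edges D) {1..?N}"
  proof (rule bij_betw_if_onto_card)
    show "{1..?N} \<subseteq> f ` (pverts D <+> und_edges D)"
    proof
      fix t assume t: "t \<in> {1..?N}"
      then consider v where "v \<in> pverts D" "l v = t - 1"
        | x y where "(x, y) \<in> parcs D" "l x + l y + (t - 1) = w"
        using assms(2)[unfolded arc_magic_def, rule_format, of "t - 1"] by fastforce
      then show "t \<in> f ` (pverts D <+> und_edges D)"
      proof cases
        case 1
        then show ?thesis
          using t by (intro image_eqI[of _ _ "Inl v"]) (auto simp: f_def)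
      next
        case 2
        then show ?thesis
          using t edge[OF 2(1)]
          by (intro image_eqI[of _ _ "Inr {x, y}"]) (auto simp: und_edges_def)
      qed
    qed
    have "finite (und_edges D)"
      unfolding und_edges_eq by (rule finite_imageI[OF simple_digraphD(2)[OF assms(1)]])
    then show "finite (pverts D <+> und_edges D)"
      and "card (pverts D <+> und_edges D) = card {1..?N}"
      using simple_digraphD(1)[OF assms(1)] card_und_edges[OF assms(1)]
      by (simp_all add: card_Plus)
  qed
  moreover have "f (Inl x) + f (Inr {x, y}) + f (Inl y) = w + 3" if "{x, y} \<in> und_edges D" for x y
  proof -
    have "(x, y) \<in> parcs D \<or> (y, x) \<in> parcs D"
      using that by (auto simp: und_edges_def doubleton_eq_iff)
    then show ?thesis
      using edge[of x y] edge[of y x] by (auto simp: f_def insert_commute)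
  qed
  ultimately show ?thesis
    unfolding edge_magic_labeling_def card_und_edges[OF assms(1)] by blast
qed

section \<open>Members of the family as super labelings\<close>

lemma sem_digraphs_pverts:
  assumes "G \<in> sem_digraphs n k"
  shows "pverts G = {1..n}"
proof -
  obtain f where "super_edge_magic_labeling G f k" "\<forall>v\<in>pverts G. f (Inl v) = v"
    using assms unfolding sem_digraphs_def by blast
  then have "pverts G = {1..card (pverts G)}"
    by (simp add: super_edge_magic_labeling_def image_image)
  then show ?thesis
    using assms by (simp add: sem_digraphs_def)
qed

text \<open>The three labels on an edge each drop by 1, and the edge label drops by another
  \<open>n\<close>, since edge labels start at \<open>n + 1\<close> and are now counted from
  0.\<close>

lemma sem_digraphs_super_arc_magic:
  assumes "G \<in> sem_digraphs n k"
  shows "super_arc_magic G (\<lambda>v. v - 1) (k - n - 3)"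
proof -
  have simple: "simple_digraph G" and card: "card (pverts G) = n" "card (parcs G) = n"
    using assms by (auto simp: sem_digraphs_def)
  obtain f where f: "edge_magic_labeling G f k" and fv: "\<And>v. v \<in> pverts G \<Longrightarrow> f (Inl v) = v"
    using assms by (auto simp: sem_digraphs_def super_edge_magic_labeling_def)
  have V: "pverts G = {1..n}"
    by (rule sem_digraphs_pverts[OF assms])
  have "\<exists>(x, y)\<in>parcs G. (x - 1) + (y - 1) + t = k - n - 3" if "t < n" for t
  proof -
    have "f ` (pverts G <+> und_edges G) = {1..n + n}"
      using f card card_und_edges[OF simple]
      by (simp add: edge_magic_labeling_def bij_betw_def)
    then have "n + 1 + t \<in> f ` (pverts G <+> und_edges G)"
      using that by simp
    \<comment> \<open>The vertices use up only the labels \<open>1\<close> to \<open>n\<close>, so a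
      larger label sits on an edge.\<close>
    then obtain E where E: "E \<in> und_edges G" "f (Inr E) = n + 1 + t"
      using fv V by force
    then obtain x y where xy: "(x, y) \<in> parcs G" "E = {x, y}"
      by (auto simp: und_edges_def)
    \<comment> \<open>With \<open>x\<close> and \<open>y\<close> positive and the edge label above
      \<open>n\<close>, all the truncated subtractions are exact.\<close>
    have "x \<in> {1..n}" "y \<in> {1..n}"
      using simple_digraphD(4,5)[OF simple xy(1)] V by simp_all
    moreover have "x + f (Inr {x, y}) + y = k"
      using f fv E(1) xy calculation V unfolding edge_magic_labeling_def by metis
    ultimately show ?thesis
      using xy E(2) by (intro bexI[OF _ xy(1)]) auto
  qed
  moreover have "\<exists>v\<in>pverts G. v - 1 = t" if "t < n" for t
    using that V by (intro bexI[of _ "Suc t"]) auto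
  ultimately show ?thesis
    using card by (simp add: super_arc_magic_def)
qed

text \<open>Some arc carries the largest label \<open>card (pverts D) - 1\<close>, and its ends have
  distinct labels, which add up to at least 1. This bound is what later separates the magic
  sums.\<close>

lemma super_arc_magic_ge_card:
  assumes "simple_digraph D" and "super_arc_magic D l w"
  shows "card (pverts D) \<le> w"
proof -
  let ?M = "card (pverts D)"
  have "bij_betw l (pverts D) {..<?M}"
    using assms(2) simple_digraphD(1)[OF assms(1)]
    by (intro bij_betw_if_onto_card) (auto simp: super_arc_magic_def)
  then have inj: "inj_on l (pverts D)"
    by (simp add: bij_betw_def)
  have M: "?M - 1 < ?M"
    using simple_digraphD(1,3)[OF assms(1)] by (simp add: card_gt_0_iff)
  then obtain x y where xy: "(x, y) \<in> parcs D" "l x + l y + (?M - 1) = w"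
    using assms(2) unfolding super_arc_magic_def by blast
  have "l x \<noteq> l y"
    using inj simple_digraphD(4-6)[OF assms(1) xy(1)] by (simp add: inj_on_eq_iff)
  then show ?thesis
    using xy(2) M by linarith
qed

section \<open>Inserting the bit at either end\<close>

text \<open>Vertices keep their labels and every arc label is raised by the order: the bit is the
  leading digit.\<close>

lemma super_arc_magic_high_bit:
  assumes "super_arc_magic D l w"
  shows "arc_magic D l (w + card (pverts D))"
  unfolding arc_magic_def
proof (intro allI impI)
  let ?M = "card (pverts D)"
  fix t assume t: "t < ?M + card (parcs D)"
  show "(\<exists>v\<in>pverts D. l v = t) \<or> (\<exists>(x, y)\<in>parcs D. l x + l y + t = w + ?M)"
  proof (cases "t < ?M")
    case True
    then show ?thesis
      using assms by (auto simp: super_arc_magic_def)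
  next
    case False
    then have "t - ?M < ?M"
      using t assms by (auto simp: super_arc_magic_def)
    then obtain x y where xy: "(x, y) \<in> parcs D" "l x + l y + (t - ?M) = w"
      using assms unfolding super_arc_magic_def by blast
    then show ?thesis
      using False by (intro disjI2 bexI[OF _ xy(1)]) auto
  qed
qed

text \<open>Vertices receive the even labels and arcs the odd ones, an arc label \<open>t\<close>
  becoming \<open>2 * t + 1\<close>.\<close>

lemma super_arc_magic_low_bit:
  assumes "super_arc_magic D l w"
  shows "arc_magic D (\<lambda>v. 2 * l v) (2 * w + 1)"
  unfolding arc_magic_def
proof (intro allI impI)
  let ?M = "card (pverts D)"
  fix t assume "t < ?M + card (parcs D)"
  then have t: "t div 2 < ?M"
    using assms by (auto simp: super_arc_magic_def)
  show "(\<exists>v\<in>pverts D. 2 * l v = t) \<or> (\<exists>(x, y)\<in>parcs D. 2 * l x + 2 * l y + t = 2 * w + 1)"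
  proof (cases "even t")
    case True
    then show ?thesis
      using t assms by (fastforce simp: super_arc_magic_def)
  next
    case False
    obtain x y where xy: "(x, y) \<in> parcs D" "l x + l y + t div 2 = w"
      using t assms unfolding super_arc_magic_def by blast
    then show ?thesis
      using False by (intro disjI2 bexI[OF _ xy(1)]) (auto elim!: oddE)
  qed
qed

section \<open>Products with the family\<close>

locale sem_product =
  fixes D :: "'a pair_pre_digraph" and h :: "'a \<times> 'a \<Rightarrow> nat pair_pre_digraph" and n k :: nat
  assumes simple: "simple_digraph D"
    and family: "h \<in> parcs D \<rightarrow> sem_digraphs n k"
begin

abbreviation P :: "('a \<times> nat) pair_pre_digraph" where
  "P \<equiv> otimes_digraph D h {1..n}"

definition digit_label :: "('a \<Rightarrow> nat) \<Rightarrow> 'a \<times> nat \<Rightarrow> nat" where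
  "digit_label l = (\<lambda>(a, x). n * l a + (x - 1))"

lemma parcs_P:
  "parcs P = (\<lambda>((a, b), (x, y)). ((a, x), (b, y))) ` (SIGMA e:parcs D. parcs (h e))"
  by (force simp: otimes_digraph_def)

lemma family_simple: "e \<in> parcs D \<Longrightarrow> simple_digraph (h e)"
  using family by (auto simp: sem_digraphs_def Pi_iff)

lemma family_super: "e \<in> parcs D \<Longrightarrow> super_arc_magic (h e) (\<lambda>v. v - 1) (k - n - 3)"
  using family by (blast intro: sem_digraphs_super_arc_magic)

lemma family_card: "e \<in> parcs D \<Longrightarrow> card (pverts (h e)) = n"
  using family by (auto simp: sem_digraphs_def Pi_iff)

lemma card_P:
  "card (pverts P) = card (pverts D) * n" "card (parcs P) = card (parcs D) * n"
proof -
  show "card (pverts P) = card (pverts D) * n"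
    by (simp add: otimes_digraph_def card_cartesian_product)
  have "card (parcs P) = card (SIGMA e:parcs D. parcs (h e))"
    unfolding parcs_P by (intro card_image) (auto simp: inj_on_def)
  also have "\<dots> = (\<Sum>e\<in>parcs D. card (parcs (h e)))"
    using simple_digraphD(2)[OF simple] simple_digraphD(2)[OF family_simple] by simp
  also have "\<dots> = (\<Sum>e\<in>parcs D. n)"
    using family by (intro sum.cong) (auto simp: sem_digraphs_def Pi_iff)
  finally show "card (parcs P) = card (parcs D) * n"
    by simp
qed

lemma simple_P:
  assumes "n > 0"
  shows "simple_digraph P"
proof -
  have "finite (parcs P)"
    unfolding parcs_P
    using simple_digraphD(2)[OF simple] simple_digraphD(2)[OF family_simple] by auto
  moreover have "parcs P \<subseteq> pverts P \<times> pverts P"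
  proof -
    have "x \<in> {1..n}" "y \<in> {1..n}" if "e \<in> parcs D" "(x, y) \<in> parcs (h e)" for e x y
      using simple_digraphD(4,5)[OF family_simple that(2)] that(1)
        sem_digraphs_pverts[of "h e" n k] family by (auto simp: Pi_iff)
    then show ?thesis
      using simple_digraphD(4,5)[OF simple] by (fastforce simp: otimes_digraph_def)
  qed
  moreover have "finite (pverts P)" "pverts P \<noteq> {}"
    using assms simple_digraphD(1,3)[OF simple] by (simp_all add: otimes_digraph_def)
  moreover have "(v, u) \<notin> parcs P" if "(u, v) \<in> parcs P" for u v
    using that simple_digraphD(7)[OF simple] by (auto simp: otimes_digraph_def)
  ultimately show ?thesis
    by (intro simple_digraphI)
qed

lemma vertex_P:
  assumes "v \<in> pverts D" and "l v = t div n" and "n > 0"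
  shows "\<exists>v\<in>pverts P. digit_label l v = t"
  using assms
  by (intro bexI[of _ "(v, Suc (t mod n))"])
    (auto simp: digit_label_def otimes_digraph_def Suc_le_eq)

text \<open>The leading part \<open>t div n\<close> is realized by an arc of \<open>D\<close> and
  the last digit \<open>t mod n\<close> by an arc of the factor chosen for it. All factors have the
  same magic sum, so the total does not depend on that choice.\<close>

lemma arc_P:
  assumes "(a, b) \<in> parcs D" and "l a + l b + t div n = w" and "n > 0"
  shows "\<exists>(x, y)\<in>parcs P. digit_label l x + digit_label l y + t = n * w + (k - n - 3)"
proof -
  have "t mod n < card (pverts (h (a, b)))"
    using assms family_card by simp
  then obtain x y where xy: "(x, y) \<in> parcs (h (a, b))" "(x - 1) + (y - 1) + t mod n = k - n - 3"
    using family_super[OF assms(1)] unfolding super_arc_magic_def by blast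
  have "n * w = n * l a + n * l b + n * (t div n)"
    unfolding assms(2)[symmetric] by (simp add: algebra_simps)
  moreover have "t = n * (t div n) + t mod n"
    by simp
  ultimately have "digit_label l (a, x) + digit_label l (b, y) + t = n * w + (k - n - 3)"
    using xy(2) unfolding digit_label_def prod.case by linarith
  moreover have "((a, x), (b, y)) \<in> parcs P"
    using assms(1) xy(1) by (simp add: otimes_digraph_def)
  ultimately show ?thesis
    by blast
qed

text \<open>Only the leading part \<open>t div n\<close> decides between vertex and arc; the
  appended digit works in both cases. So a bit inserted earlier stays where it was among the leading
  digits.\<close>

lemma arc_magic_P:
  assumes "arc_magic D l w" and "n > 0"
  shows "arc_magic P (digit_label l) (n * w + (k - n - 3))"
  unfolding arc_magic_def card_P
proof (intro allI impI)
  fix t assume "t < card (pverts D) * n + card (parcs D) * n"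
  then have "t div n < card (pverts D) + card (parcs D)"
    by (simp add: less_mult_imp_div_less algebra_simps)
  then consider v where "v \<in> pverts D" "l v = t div n"
    | a b where "(a, b) \<in> parcs D" "l a + l b + t div n = w"
    using assms(1) unfolding arc_magic_def by blast
  then show "(\<exists>v\<in>pverts P. digit_label l v = t) \<or>
      (\<exists>(x, y)\<in>parcs P. digit_label l x + digit_label l y + t = n * w + (k - n - 3))"
    using vertex_P[OF _ _ assms(2)] arc_P[OF _ _ assms(2)] by cases blast+
qed

lemma super_arc_magic_P:
  assumes "super_arc_magic D l w" and "n > 0"
  shows "super_arc_magic P (digit_label l) (n * w + (k - n - 3))"
  unfolding super_arc_magic_def card_P
proof (intro allI impI conjI)
  show "card (parcs D) * n = card (pverts D) * n"
    using assms(1) by (simp add: super_arc_magic_def)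
  fix t assume "t < card (pverts D) * n"
  then have "t div n < card (pverts D)"
    by (simp add: less_mult_imp_div_less)
  then obtain v a b where "v \<in> pverts D" "l v = t div n"
    and "(a, b) \<in> parcs D" "l a + l b + t div n = w"
    using assms(1) unfolding super_arc_magic_def by blast
  then show "\<exists>v\<in>pverts P. digit_label l v = t"
    and "\<exists>(x, y)\<in>parcs P. digit_label l x + digit_label l y + t = n * w + (k - n - 3)"
    using vertex_P[OF _ _ assms(2)] arc_P[OF _ _ assms(2)] by blast+
qed

end

section \<open>Growth of the set of magic sums\<close>

text \<open>
  The bound \<open>2 w + 1\<close> is the magic sum of the labeling with the bit in the lowest position;
  requiring it of all sums makes the sum added by the next product a new one.
\<close>

definition many_magic_sums :: "'a pair_pre_digraph \<Rightarrow> nat \<Rightarrow> bool" where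
  "many_magic_sums D m \<longleftrightarrow> simple_digraph D \<and>
     (\<exists>l w T. super_arc_magic D l w \<and> finite T \<and> card T = m \<and>
        (\<forall>u\<in>T. u \<le> 2 * w + 1 \<and> (\<exists>l. arc_magic D l u)))"

lemma many_magic_sumsI:
  assumes "simple_digraph D" and "super_arc_magic D l w" and "finite T" and "card T = m"
    and "\<forall>u\<in>T. u \<le> 2 * w + 1 \<and> (\<exists>l. arc_magic D l u)"
  shows "many_magic_sums D m"
  unfolding many_magic_sums_def
  by (intro conjI exI[of _ l] exI[of _ w] exI[of _ T] assms)

text \<open>The bit can be placed at the top or at the bottom. The two sums differ because the order
  is at most \<open>w\<close>.\<close>

lemma many_magic_sums_sem:
  assumes "D \<in> sem_digraphs p s"
  shows "many_magic_sums D 2"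
proof -
  have simple: "simple_digraph D"
    using assms by (simp add: sem_digraphs_def)
  define w where "w = s - p - 3"
  have super: "super_arc_magic D (\<lambda>v. v - 1) w"
    unfolding w_def by (rule sem_digraphs_super_arc_magic[OF assms])
  have le: "card (pverts D) \<le> w"
    by (rule super_arc_magic_ge_card[OF simple super])
  have bound: "\<forall>u\<in>{w + card (pverts D), 2 * w + 1}. u \<le> 2 * w + 1 \<and> (\<exists>l. arc_magic D l u)"
    using super_arc_magic_high_bit[OF super] super_arc_magic_low_bit[OF super] le by auto
  have "card {w + card (pverts D), 2 * w + 1} = 2"
    using le by simp
  from many_magic_sumsI[OF simple super _ this bound] show ?thesis
    by simp
qed

text \<open>Labelings are carried over by composing with \<open>inv g\<close>, and the sums stay the
  same.\<close>

lemma many_magic_sums_rename: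
  assumes "many_magic_sums D m" and "inj g"
  shows "many_magic_sums (rename_digraph g D) m"
proof -
  have lift: "l \<circ> inv g \<circ> g = l" for l :: "'a \<Rightarrow> nat"
    using assms(2) by (simp add: comp_assoc)
  obtain l w T where super: "super_arc_magic D l w" and T: "finite T" "card T = m"
    "\<forall>u\<in>T. u \<le> 2 * w + 1 \<and> (\<exists>l. arc_magic D l u)"
    using assms(1) by (auto simp: many_magic_sums_def)
  have super': "super_arc_magic (rename_digraph g D) (l \<circ> inv g) w"
    unfolding super_arc_magic_rename[OF assms(2)] lift by (rule super)
  have "\<exists>l. arc_magic (rename_digraph g D) l u" if "u \<in> T" for u
  proof -
    have "\<exists>l. arc_magic D l u"
      using T(3) that by simp
    then obtain l where "arc_magic D l u" ..
    then have "arc_magic (rename_digraph g D) (l \<circ> inv g) u"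
      unfolding arc_magic_rename[OF assms(2)] lift .
    then show ?thesis
      by (intro exI[of _ "l \<circ> inv g"])
  qed
  then show ?thesis
    using T assms(1) simple_rename_digraph[OF _ assms(2)]
    by (intro many_magic_sumsI[OF _ super' T(1,2)]) (simp_all add: many_magic_sums_def)
qed

text \<open>Old sums pass through the injective map \<open>u \<mapsto> n * u + c\<close>; the low
  bit of the product supplies one sum above all of these.\<close>

lemma many_magic_sums_product:
  assumes "many_magic_sums D m" and "h \<in> parcs D \<rightarrow> sem_digraphs n k"
  shows "many_magic_sums (otimes_digraph D h {1..n}) (Suc m)"
proof -
  obtain l w T where simple: "simple_digraph D" and super: "super_arc_magic D l w"
    and T: "finite T" "card T = m"
    and sums: "\<And>u. u \<in> T \<Longrightarrow> u \<le> 2 * w + 1" "\<And>u. u \<in> T \<Longrightarrow> \<exists>l. arc_magic D l u"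
    using assms(1) by (auto simp: many_magic_sums_def)
  interpret sem_product D h n k
    using simple assms(2) by unfold_locales
  \<comment> \<open>An arc of \<open>D\<close> provides a member of the family, from which
    \<open>n > 0\<close> and \<open>n \<le> c\<close> are read off.\<close>
  have "card (parcs D) > 0"
    using super simple_digraphD(1,3)[OF simple] by (simp add: super_arc_magic_def card_gt_0_iff)
  then obtain e where e: "e \<in> parcs D"
    by (auto simp: card_gt_0_iff simp flip: ex_in_conv)
  have n: "n > 0"
    using simple_digraphD(1,3)[OF family_simple[OF e]] family_card[OF e] card_gt_0_iff by metis
  define c where "c = k - n - 3"
  have "n \<le> c"
    using super_arc_magic_ge_card[OF family_simple[OF e] family_super[OF e]] family_card[OF e]
    by (simp add: c_def)
  define T' where "T' = (\<lambda>u. n * u + c) ` T"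
  have less: "u < 2 * (n * w + c) + 1" if "u \<in> T'" for u
  proof -
    obtain v where v: "v \<in> T" "u = n * v + c"
      using \<open>u \<in> T'\<close> by (auto simp: T'_def)
    \<comment> \<open>This gives \<open>u \<le> 2 * n * w + n + c\<close>, and
      \<open>n \<le> c\<close> turns it into a strict bound by the new sum.\<close>
    have "n * v \<le> n * (2 * w + 1)"
      using sums(1)[OF v(1)] by (rule mult_le_mono2)
    then show ?thesis
      using v(2) \<open>n \<le> c\<close> by (simp add: algebra_simps)
  qed
  have super': "super_arc_magic P (digit_label l) (n * w + c)"
    unfolding c_def by (rule super_arc_magic_P[OF super n])
  have "card T' = m"
    unfolding T'_def using T(2) n by (subst card_image) (auto simp: inj_on_def)
  moreover have "2 * (n * w + c) + 1 \<notin> T'"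
    using less by blast
  ultimately have "card (insert (2 * (n * w + c) + 1) T') = Suc m"
    using T(1) by (simp add: T'_def)
  moreover have "finite (insert (2 * (n * w + c) + 1) T')"
    using T(1) by (simp add: T'_def)
  moreover have "\<exists>l. arc_magic P l u" if "u \<in> T'" for u
  proof -
    obtain v where v: "v \<in> T" "u = n * v + c"
      using \<open>u \<in> T'\<close> by (auto simp: T'_def)
    obtain l where "arc_magic D l v"
      using sums(2)[OF v(1)] by (rule exE)
    then show ?thesis
      unfolding v(2) c_def by (intro exI) (rule arc_magic_P[OF _ n])
  qed
  then have "\<forall>u\<in>insert (2 * (n * w + c) + 1) T'.
      u \<le> 2 * (n * w + c) + 1 \<and> (\<exists>l. arc_magic P l u)"
    using exI[of "\<lambda>l. arc_magic P l _", OF super_arc_magic_low_bit[OF super']] less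
    by (simp add: less_imp_le)
  ultimately show ?thesis
    by (intro many_magic_sumsI[OF simple_P[OF n] super'])
qed

lemma many_magic_sums_imp_labelings:
  assumes "many_magic_sums D m"
  shows "\<exists>f \<sigma>. (\<forall>j\<in>{1..m}. edge_magic_labeling D (f j) (\<sigma> j)) \<and> inj_on \<sigma> {1..m}"
proof -
  obtain T where simple: "simple_digraph D" and T: "finite T" "card T = m"
    and sums: "\<And>u. u \<in> T \<Longrightarrow> \<exists>l. arc_magic D l u"
    using assms by (auto simp: many_magic_sums_def)
  \<comment> \<open>Enumerating \<open>T\<close> makes distinct sums into an injective indexing by
    \<open>{1..m}\<close>.\<close>
  obtain \<tau> where \<tau>: "bij_betw \<tau> {1..m} T"
    using ex_bij_betw_nat_finite_1[OF T(1)] T(2) by auto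
  have "\<forall>j\<in>{1..m}. \<exists>f. edge_magic_labeling D f (\<tau> j + 3)"
  proof
    fix j assume "j \<in> {1..m}"
    from sums[OF bij_betw_apply[OF \<tau> this]] obtain l where "arc_magic D l (\<tau> j)" ..
    then show "\<exists>f. edge_magic_labeling D f (\<tau> j + 3)"
      by (rule arc_magic_imp_edge_magic_labeling[OF simple])
  qed
  from bchoice[OF this] obtain f where "\<forall>j\<in>{1..m}. edge_magic_labeling D (f j) (\<tau> j + 3)" ..
  moreover have "inj_on (\<lambda>j. \<tau> j + 3) {1..m}"
    by (rule inj_onI) (simp add: inj_on_eq_iff[OF bij_betw_imp_inj_on[OF \<tau>]])
  ultimately show ?thesis
    by (intro exI[of _ f] exI[of _ "\<lambda>j. \<tau> j + 3"] conjI)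
qed

section \<open>Induction along the iterated product\<close>

theorem theorem4p4:
  fixes p s n k :: nat
    and D :: "nat pair_pre_digraph"
    and Ds :: "nat \<Rightarrow> vertex pair_pre_digraph"
    and h :: "nat \<Rightarrow> vertex \<times> vertex \<Rightarrow> nat pair_pre_digraph"
  assumes "D \<in> sem_digraphs p s"
    and "Ds 1 = rename_digraph Vert D"
    and "\<And>i. i \<ge> 1 \<Longrightarrow> h i \<in> parcs (Ds i) \<rightarrow> sem_digraphs n k"
    and "\<And>i. i \<ge> 1 \<Longrightarrow>
           Ds (Suc i) = rename_digraph (\<lambda>(a, x). VPair a x) (otimes_digraph (Ds i) (h i) {1..n})"
  shows "\<forall>i\<ge>1. \<exists>f \<sigma>. (\<forall>j\<in>{1..i + 1}. edge_magic_labeling (Ds i) (f j) (\<sigma> j)) \<and> inj_on \<sigma> {1..i + 1}"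
proof (intro allI impI)
  fix i :: nat
  assume "i \<ge> 1"
  then have "many_magic_sums (Ds i) (i + 1)"
  proof (induction i rule: nat_induct_at_least)
    case base
    have "many_magic_sums D (1 + 1)"
      using many_magic_sums_sem[OF assms(1)] by (simp add: numeral_2_eq_2)
    then show ?case
      unfolding assms(2) by (rule many_magic_sums_rename) (simp add: inj_def)
  next
    case (Suc i)
    \<comment> \<open>Free constructors make the renaming injective, so the sums of the product
      survive the return to the type \<open>vertex\<close>.\<close>
    have "inj (\<lambda>(a, x). VPair a x)"
      by (auto simp: inj_def)
    with many_magic_sums_product[OF Suc.IH assms(3)[OF Suc.hyps]] show ?case
      unfolding assms(4)[OF Suc.hyps] by (simp add: many_magic_sums_rename)
  qed
  then show "\<exists>f \<sigma>. (\<forall>j\<in>{1..i + 1}. edge_magic_labeling (Ds i) (f j) (\<sigma> j)) \<and>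
      inj_on \<sigma> {1..i + 1}"
    by (rule many_magic_sums_imp_labelings)
qed

end
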